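(* For every $\lambda<1$ and every odd positive integer $D$, there exists $\lambda'<1$ (depending only on $\lambda$ and $D$) such that for every $N$, if $G$ is an $(N,D,\lambda)$-graph and $C$ is the cycle on $D$ vertices, then the zig-zag product of $G$ (as the large graph) with $C$ (as the small graph) is an $(ND,4,\lambda')$-graph.
   Context: For a positive integer $n$, $[n]=\{1,\dots,n\}$. Graphs are finite, undirected and regular, and may have self-loops and parallel edges. A $D$-regular graph $G$ on $[N]$ is specified by its rotation map $\mathrm{Rot}_G:[N]\times[D]\to[N]\times[D]$: $\mathrm{Rot}_G(v,i)=(w,j)$ means that the $i$-th edge incident to $v$ leads to $w$ and that this edge is the $j$-th edge incident to $w$. Thus $\mathrm{Rot}_G$ is a permutation with $\mathrm{Rot}_G\circ\mathrm{Rot}_G=\mathrm{id}$ (and any such involution specifies a $D$-regular graph). Vertex sets and sets of edge labels may be any finite sets of the right cardinality. The cycle $C$ is the 2-regular graph on $[D]$ in which $i$ is joined to $i\pm1$ modulo $D$ (with any edge labeling). The normalized adjacency matrix of $G$ is the symmetric $N\times N$ matrix with $M_{u,v}=\frac1D|\{(i,j)\in[D]^2:\mathrm{Rot}_G(u,i)=(v,j)\}|$. The second largest eigenvalue in absolute value is $\lambda(G)=\max_{\alpha\perp 1_N,\,\alpha\ne0}\|M\alpha\|/\|\alpha\|$, where $1_N$ is the all-ones vector and the norm is Euclidean (with $\lambda(G)=0$ if $N=1$). An $(N,D,\lambda)$-graph is a $D$-regular graph on $N$ vertices with $\lambda(G)\le\lambda$. Zig-zag product: for a $D_1$-regular graph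 $G_1$ on $[N_1]$ (the large graph) and a $D_2$-regular graph $G_2$ on $[D_1]$ (the small graph), it is the $D_2^2$-regular graph on $[N_1]\times[D_1]$, with edge labels in $[D_2]\times[D_2]$, whose rotation map sends $((v,k),(i,j))$ to $((w,\ell),(j',i'))$, where $(k',i')=\mathrm{Rot}_{G_2}(k,i)$, then $(w,\ell')=\mathrm{Rot}_{G_1}(v,k')$, then $(\ell,j')=\mathrm{Rot}_{G_2}(\ell',j)$. *)

theory Defs
  imports "HOL-Analysis.Analysis" "HOL-Number_Theory.Cong"
begin

text \<open>A finite regular graph, with self-loops and parallel edges allowed, given by its rotation
  map: if \<open>rot G (v, i) = (w, j)\<close> then the \<open>i\<close>-th edge at \<open>v\<close> is the \<open>j\<close>-th edge at \<open>w\<close>.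
  Values of the rotation map outside \<open>verts G \<times> labels G\<close> carry no meaning.\<close>

record ('v, 'l) rot_graph =
  verts :: "'v set"
  labels :: "'l set"
  rot :: "'v \<times> 'l \<Rightarrow> 'v \<times> 'l"

definition regular_graph :: "('v, 'l) rot_graph \<Rightarrow> bool" where
  "regular_graph G \<longleftrightarrow>
     finite (verts G) \<and> verts G \<noteq> {} \<and> finite (labels G) \<and> labels G \<noteq> {} \<and>
     (\<forall>x \<in> verts G \<times> labels G. rot G x \<in> verts G \<times> labels G \<and> rot G (rot G x) = x)"

definition adj_entry :: "('v, 'l) rot_graph \<Rightarrow> 'v \<Rightarrow> 'v \<Rightarrow> real" where
  "adj_entry G u v =
     real (card {(i, j). i \<in> labels G \<and> j \<in> labels G \<and> rot G (u, i) = (v, j)})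
       / real (card (labels G))"

definition adj_mult :: "('v, 'l) rot_graph \<Rightarrow> ('v \<Rightarrow> real) \<Rightarrow> 'v \<Rightarrow> real" where
  "adj_mult G \<alpha> u = (\<Sum>v\<in>verts G. adj_entry G u v * \<alpha> v)"

text \<open>Vectors are functions of which only the values on \<open>verts G\<close> matter. The supremum is over a
  nonempty bounded set as soon as there are two vertices, and it is a maximum, because the quotient
  is invariant under scaling and continuous on the (compact) unit sphere of the orthogonal
  complement of the all-ones vector.\<close>

definition second_eigenvalue :: "('v, 'l) rot_graph \<Rightarrow> real" where
  "second_eigenvalue G =
     (if card (verts G) = 1 then 0
      else SUP \<alpha> \<in> {\<alpha>. (\<Sum>v\<in>verts G. \<alpha> v) = 0 \<and> (\<exists>v\<in>verts G. \<alpha> v \<noteq> 0)}.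
             L2_set (adj_mult G \<alpha>) (verts G) / L2_set \<alpha> (verts G))"

definition spectral_graph :: "nat \<Rightarrow> nat \<Rightarrow> real \<Rightarrow> ('v, 'l) rot_graph \<Rightarrow> bool" where
  "spectral_graph N D \<mu> G \<longleftrightarrow>
     regular_graph G \<and> card (verts G) = N \<and> card (labels G) = D \<and> second_eigenvalue G \<le> \<mu>"

text \<open>The cycle with an arbitrary labeling: at each vertex, either of the two labels may be the one
  leading to the successor. For \<open>D = 1\<close> both edge ends at the only vertex lead back to it.\<close>

definition cycle_graph :: "nat \<Rightarrow> (nat, nat) rot_graph \<Rightarrow> bool" where
  "cycle_graph D C \<longleftrightarrow>
     regular_graph C \<and> verts C = {1..D} \<and> labels C = {1..2} \<and>
     (\<forall>v \<in> {1..D}. \<exists>i j. {i, j} = {1..2} \<and>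
        [int (fst (rot C (v, i))) = int v + 1] (mod int D) \<and>
        [int (fst (rot C (v, j))) = int v - 1] (mod int D))"

text \<open>Meaningful when \<open>labels G = verts H\<close>.\<close>

definition zigzag :: "('v, 'k) rot_graph \<Rightarrow> ('k, 'l) rot_graph \<Rightarrow> ('v \<times> 'k, 'l \<times> 'l) rot_graph" where
  "zigzag G H =
     \<lparr> verts = verts G \<times> verts H,
       labels = labels H \<times> labels H,
       rot = (\<lambda>((v, k), (i, j)).
         let (k', i') = rot H (k, i);
             (w, l') = rot G (v, k');
             (l, j') = rot H (l', j)
         in ((w, l), (j', i'))) \<rparr>"

end

theory Submission
  imports Defs
begin

text \<open>The normalized adjacency operator of the zig-zag product is \<open>B P B\<close>, where \<open>B\<close> applies the
  small graph on every fiber and \<open>P\<close> permutes coordinates by the rotation map of the large graph.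
  Split a vector of mean zero into its part constant on fibers and its part of mean zero on fibers.
  If the second part is not small, the first \<open>B\<close> shrinks the vector. Otherwise \<open>P\<close> acts on the fiber
  means essentially as the large graph does, so it turns a definite proportion of the vector into
  one of mean zero on fibers, which the second \<open>B\<close> shrinks.

  For the cycle, \<open>\<parallel>x\<parallel>\<^sup>2 - \<parallel>B x\<parallel>\<^sup>2\<close> is a quarter of the sum of the \<open>(x (t + 2) - x t)\<^sup>2\<close>. As \<open>D\<close> is odd,
  steps of length 2 connect all vertices, which yields a spectral gap depending only on \<open>D\<close>.\<close>

section \<open>Sums of squares and means\<close>

lemma L2_set_power2: "(L2_set f A)\<^sup>2 = (\<Sum>x\<in>A. (f x)\<^sup>2)"
  by (simp add: L2_set_def sum_nonneg)

text \<open>Pythagoras: the deviations from the mean sum to zero, so they are orthogonal to the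
  constants and the cross term vanishes.\<close>

lemma sum_power2_deviation:
  fixes f :: "'a \<Rightarrow> real" and m :: real
  assumes "finite A" "A \<noteq> {}" and m: "m = (\<Sum>x\<in>A. f x) / card A"
  shows "(\<Sum>x\<in>A. (f x)\<^sup>2) = card A * m\<^sup>2 + (\<Sum>x\<in>A. (f x - m)\<^sup>2)"
proof -
  have s: "(\<Sum>x\<in>A. f x) = card A * m"
    using assms by auto
  have "(\<Sum>x\<in>A. (f x - m)\<^sup>2) = (\<Sum>x\<in>A. (f x)\<^sup>2) - 2 * m * (\<Sum>x\<in>A. f x) + card A * m\<^sup>2"
    by (simp add: power2_diff sum.distrib sum_subtractf sum_distrib_left sum_distrib_right ac_simps)
  then show ?thesis
    unfolding s by (simp add: power2_eq_square algebra_simps)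
qed

lemma power2_mean_le:
  fixes f :: "'a \<Rightarrow> real"
  assumes "finite A" "A \<noteq> {}"
  shows "((\<Sum>x\<in>A. f x) / card A)\<^sup>2 \<le> (\<Sum>x\<in>A. (f x)\<^sup>2) / card A"
proof -
  have "card A * ((\<Sum>x\<in>A. f x) / card A)\<^sup>2 \<le> (\<Sum>x\<in>A. (f x)\<^sup>2)"
    by (subst sum_power2_deviation[OF assms refl]) (simp add: sum_nonneg)
  then show ?thesis
    using assms by (simp add: field_simps card_gt_0_iff)
qed

section \<open>Rotation maps and the adjacency operator\<close>

lemma regular_graphD:
  assumes "regular_graph G"
  shows "finite (verts G)" "verts G \<noteq> {}" "finite (labels G)" "labels G \<noteq> {}"
    and "\<And>x. x \<in> verts G \<times> labels G \<Longrightarrow> rot G x \<in> verts G \<times> labels G"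
    and "\<And>x. x \<in> verts G \<times> labels G \<Longrightarrow> rot G (rot G x) = x"
    and "card (verts G) > 0" "card (labels G) > 0"
  using assms by (auto simp: regular_graph_def card_gt_0_iff)

lemma sum_rot:
  assumes "regular_graph G"
  shows "(\<Sum>x\<in>verts G \<times> labels G. f (rot G x)) = (\<Sum>x\<in>verts G \<times> labels G. f x)"
  by (rule sum.reindex_bij_witness[of _ "rot G" "rot G"])
    (use regular_graphD(5,6)[OF assms] in auto)

text \<open>At a fixed \<open>u\<close>, the label \<open>i\<close> determines the label
  \<open>j\<close> at the other end, so the pairs counted by \<open>adj_entry\<close> are counted by
  \<open>i\<close> alone. Everything below computes with this form instead of matrix
  entries.\<close>

lemma adj_mult_eq:
  assumes G: "regular_graph G" and u: "u \<in> verts G"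
  shows "adj_mult G \<alpha> u = (\<Sum>i\<in>labels G. \<alpha> (fst (rot G (u, i)))) / card (labels G)"
proof -
  note R = regular_graphD[OF G]
  let ?L = "labels G"
  have card: "card {(i, j). i \<in> ?L \<and> j \<in> ?L \<and> rot G (u, i) = (v, j)}
      = card {i \<in> ?L. fst (rot G (u, i)) = v}" (is "card ?A = card ?B") for v
  proof (rule bij_betw_same_card[of fst])
    show "bij_betw fst ?A ?B"
      by (rule bij_betw_byWitness[where f' = "\<lambda>i. (i, snd (rot G (u, i)))"])
        (use R(5) u in \<open>auto simp: mem_Times_iff\<close>)
  qed
  have "adj_entry G u v * \<alpha> v = (\<Sum>i\<in>?L. if fst (rot G (u, i)) = v then \<alpha> v else 0) / card ?L" for v
    using R(3) by (simp add: adj_entry_def card sum.If_cases Int_def)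
  then have "adj_mult G \<alpha> u
      = (\<Sum>v\<in>verts G. \<Sum>i\<in>?L. if fst (rot G (u, i)) = v then \<alpha> v else 0) / card ?L"
    by (simp add: adj_mult_def sum_divide_distrib)
  also have "\<dots> = (\<Sum>i\<in>?L. \<Sum>v\<in>verts G. if fst (rot G (u, i)) = v then \<alpha> v else 0) / card ?L"
    by (subst sum.swap) simp
  also have "\<dots> = (\<Sum>i\<in>?L. \<alpha> (fst (rot G (u, i)))) / card ?L"
    using R(1) R(5) u by (intro arg_cong2[where f = "(/)"] sum.cong) (auto simp: mem_Times_iff)
  finally show ?thesis .
qed

text \<open>The rotation map permutes the edge ends, and each vertex carries
  \<open>card (labels G)\<close> of them.\<close>

lemma sum_fst_rot:
  fixes f :: "'v \<Rightarrow> real"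
  assumes G: "regular_graph G"
  shows "(\<Sum>u\<in>verts G. \<Sum>i\<in>labels G. f (fst (rot G (u, i)))) = card (labels G) * (\<Sum>u\<in>verts G. f u)"
proof -
  have "(\<Sum>u\<in>verts G. \<Sum>i\<in>labels G. f (fst (rot G (u, i))))
      = (\<Sum>x\<in>verts G \<times> labels G. f (fst (rot G x)))"
    by (simp add: sum.cartesian_product case_prod_beta)
  also have "\<dots> = (\<Sum>x\<in>verts G \<times> labels G. f (fst x))"
    by (rule sum_rot[OF G])
  also have "\<dots> = (\<Sum>u\<in>verts G. \<Sum>i\<in>labels G. f u)"
    unfolding sum.cartesian_product by (simp add: case_prod_beta)
  finally show ?thesis
    by (simp add: sum_distrib_left)
qed

lemma sum_adj_mult:
  assumes G: "regular_graph G"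
  shows "(\<Sum>u\<in>verts G. adj_mult G \<alpha> u) = (\<Sum>u\<in>verts G. \<alpha> u)"
  using sum_fst_rot[OF G, of \<alpha>] regular_graphD(8)[OF G]
  by (simp add: adj_mult_eq[OF G] flip: sum_divide_distrib)

lemma adj_mult_diff_const:
  assumes G: "regular_graph G" and u: "u \<in> verts G"
  shows "adj_mult G (\<lambda>v. \<alpha> v - c) u = adj_mult G \<alpha> u - c"
  using regular_graphD(8)[OF G]
  by (simp add: adj_mult_eq[OF G u] sum_subtractf diff_divide_distrib)

section \<open>Norm bounds and the second eigenvalue\<close>

text \<open>Convexity of the square at each vertex, then \<open>sum_fst_rot\<close> for the squares.
  The bound also shows that the supremum in \<open>second_eigenvalue\<close> is taken over a bounded
  set.\<close>

lemma L2_adj_mult_le: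
  assumes G: "regular_graph G"
  shows "L2_set (adj_mult G \<alpha>) (verts G) \<le> L2_set \<alpha> (verts G)"
proof (rule power2_le_imp_le)
  note R = regular_graphD[OF G]
  have "(\<Sum>u\<in>verts G. (adj_mult G \<alpha> u)\<^sup>2)
      \<le> (\<Sum>u\<in>verts G. (\<Sum>i\<in>labels G. (\<alpha> (fst (rot G (u, i))))\<^sup>2) / card (labels G))"
    by (intro sum_mono) (simp add: adj_mult_eq[OF G] power2_mean_le R)
  also have "\<dots> = (\<Sum>u\<in>verts G. (\<alpha> u)\<^sup>2)"
    using sum_fst_rot[OF G, of "\<lambda>u. (\<alpha> u)\<^sup>2"] R(8) by (simp flip: sum_divide_distrib)
  finally show "(L2_set (adj_mult G \<alpha>) (verts G))\<^sup>2 \<le> (L2_set \<alpha> (verts G))\<^sup>2"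
    by (simp add: L2_set_power2)
qed simp

lemma L2_adj_mult_le_second_eigenvalue:
  assumes G: "regular_graph G" and s: "(\<Sum>v\<in>verts G. \<alpha> v) = 0"
  shows "L2_set (adj_mult G \<alpha>) (verts G) \<le> second_eigenvalue G * L2_set \<alpha> (verts G)"
proof (cases "\<forall>v\<in>verts G. \<alpha> v = 0")
  case True
  then have "L2_set \<alpha> (verts G) = 0"
    by (simp add: L2_set_def)
  then show ?thesis
    using L2_adj_mult_le[OF G, of \<alpha>] by simp
next
  case False
  note R = regular_graphD[OF G]
  \<comment> \<open>On a single vertex, sum zero would force the zero vector; hence the supremum
    branch of the definition applies.\<close>
  have "card (verts G) \<noteq> 1"
    using False s by (metis card_1_singletonE singletonD sum.neutral sum.insert empty_iff
        finite.emptyI sum.empty add_0_right)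
  let ?S = "{\<alpha>. (\<Sum>v\<in>verts G. \<alpha> v) = 0 \<and> (\<exists>v\<in>verts G. \<alpha> v \<noteq> 0)}"
  let ?q = "\<lambda>\<alpha>. L2_set (adj_mult G \<alpha>) (verts G) / L2_set \<alpha> (verts G)"
  \<comment> \<open>A zero denominator is harmless, since the quotient is then 0 by
    convention.\<close>
  have "?q \<beta> \<le> 1" for \<beta>
    using divide_right_mono[OF L2_adj_mult_le[OF G, of \<beta>] L2_set_nonneg[of \<beta> "verts G"]]
    by (cases "L2_set \<beta> (verts G) = 0") simp_all
  then have "bdd_above (?q ` ?S)"
    by (auto intro!: bdd_aboveI2)
  then have "?q \<alpha> \<le> second_eigenvalue G"
    unfolding second_eigenvalue_def using \<open>card (verts G) \<noteq> 1\<close> False s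
    by (auto intro!: cSUP_upper)
  moreover have "L2_set \<alpha> (verts G) > 0"
    using False R(1) by (auto simp: less_le L2_set_eq_0_iff)
  ultimately show ?thesis
    by (simp add: divide_le_eq)
qed

text \<open>The converse direction: an estimate for all vectors of sum zero bounds the supremum. The
  sign of \<open>c\<close> settles the one-vertex graph, where the value is 0 by definition.\<close>

lemma second_eigenvalue_le:
  assumes G: "regular_graph G" and "c \<ge> 0"
    and le: "\<And>\<alpha>. (\<Sum>v\<in>verts G. \<alpha> v) = 0 \<Longrightarrow>
      L2_set (adj_mult G \<alpha>) (verts G) \<le> c * L2_set \<alpha> (verts G)"
  shows "second_eigenvalue G \<le> c"
proof (cases "card (verts G) = 1")
  case True
  then show ?thesis
    using \<open>c \<ge> 0\<close> by (simp add: second_eigenvalue_def)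
next
  case False
  note R = regular_graphD[OF G]
  obtain u where u: "u \<in> verts G"
    using R(2) by blast
  have "verts G \<noteq> {u}"
    using False by auto
  then obtain w where w: "w \<in> verts G" "w \<noteq> u"
    using u by blast
  \<comment> \<open>The difference of two point masses shows that the set under the supremum is
    nonempty, as \<open>cSUP_least\<close> requires.\<close>
  define \<alpha> :: "_ \<Rightarrow> real" where "\<alpha> v = (if v = u then 1 else 0) - (if v = w then 1 else 0)" for v
  have "(\<Sum>v\<in>verts G. \<alpha> v) = 0" "\<alpha> u \<noteq> 0"
    using u w R(1) by (auto simp: \<alpha>_def sum_subtractf)
  then have ne: "{\<alpha>::_ \<Rightarrow> real. (\<Sum>v\<in>verts G. \<alpha> v) = 0 \<and> (\<exists>v\<in>verts G. \<alpha> v \<noteq> 0)} \<noteq> {}"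
    using u by blast
  show ?thesis
    unfolding second_eigenvalue_def if_not_P[OF False]
  proof (rule cSUP_least[OF ne])
    fix \<beta> :: "_ \<Rightarrow> real"
    assume "\<beta> \<in> {\<alpha>. (\<Sum>v\<in>verts G. \<alpha> v) = 0 \<and> (\<exists>v\<in>verts G. \<alpha> v \<noteq> 0)}"
    then have "(\<Sum>v\<in>verts G. \<beta> v) = 0" "L2_set \<beta> (verts G) > 0"
      using R(1) by (auto simp: less_le L2_set_eq_0_iff)
    then show "L2_set (adj_mult G \<beta>) (verts G) / L2_set \<beta> (verts G) \<le> c"
      using le by (simp add: divide_le_eq)
  qed
qed

section \<open>The zig-zag product and its factorization\<close>

text \<open>The operator \<open>B\<close> of the overview: the tensor product of the identity with
  the adjacency operator of \<open>H\<close>.\<close>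

definition fiber_mult :: "('k, 'l) rot_graph \<Rightarrow> ('v \<times> 'k \<Rightarrow> real) \<Rightarrow> 'v \<times> 'k \<Rightarrow> real" where
  "fiber_mult H \<alpha> x = adj_mult H (\<lambda>k. \<alpha> (fst x, k)) (snd x)"

definition fiber_mean :: "'k set \<Rightarrow> ('v \<times> 'k \<Rightarrow> real) \<Rightarrow> 'v \<Rightarrow> real" where
  "fiber_mean K \<alpha> v = (\<Sum>k\<in>K. \<alpha> (v, k)) / card K"

text \<open>Walking back undoes the three steps in reverse order. The output labels are swapped to
  \<open>(j', i')\<close> so that the reversed walk reads \<open>j'\<close> first.\<close>

lemma regular_graph_zigzag:
  assumes G: "regular_graph G" and H: "regular_graph H" and GH: "labels G = verts H"
  shows "regular_graph (zigzag G H)"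
proof -
  note RG = regular_graphD[OF G] and RH = regular_graphD[OF H]
  have *: "rot (zigzag G H) ((v, k), (i, j)) \<in> verts (zigzag G H) \<times> labels (zigzag G H) \<and>
      rot (zigzag G H) (rot (zigzag G H) ((v, k), (i, j))) = ((v, k), (i, j))"
    if "v \<in> verts G" "k \<in> verts H" "i \<in> labels H" "j \<in> labels H" for v k i j
  proof -
    obtain k' i' where 1: "rot H (k, i) = (k', i')" by fastforce
    obtain w l' where 2: "rot G (v, k') = (w, l')" by fastforce
    obtain l j' where 3: "rot H (l', j) = (l, j')" by fastforce
    have 4: "k' \<in> verts H" "i' \<in> labels H" "rot H (k', i') = (k, i)"
      using RH(5,6)[of "(k, i)"] that by (auto simp: 1)
    have 5: "w \<in> verts G" "l' \<in> verts H" "rot G (w, l') = (v, k')"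
      using RG(5,6)[of "(v, k')"] that 4 by (auto simp: 2 GH)
    have 6: "l \<in> verts H" "j' \<in> labels H" "rot H (l, j') = (l', j)"
      using RH(5,6)[of "(l', j)"] that 5 by (auto simp: 3)
    show ?thesis
      using 4 5 6 by (simp add: zigzag_def 1 2 3)
  qed
  show ?thesis
    unfolding regular_graph_def
  proof (intro conjI ballI)
    fix x assume "x \<in> verts (zigzag G H) \<times> labels (zigzag G H)"
    then obtain v k i j where "x = ((v, k), (i, j))"
      "v \<in> verts G" "k \<in> verts H" "i \<in> labels H" "j \<in> labels H"
      by (auto simp: zigzag_def)
    then show "rot (zigzag G H) x \<in> verts (zigzag G H) \<times> labels (zigzag G H)"
      "rot (zigzag G H) (rot (zigzag G H) x) = x"
      using * by blast+
  qed (use RG RH in \<open>auto simp: zigzag_def\<close>)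
qed

text \<open>The factorization \<open>B P B\<close>: averaging over the pair \<open>(i, j)\<close> is
  averaging over \<open>j\<close> inside, for the last small step, and over \<open>i\<close>
  outside, for the first.\<close>

lemma adj_mult_zigzag:
  assumes G: "regular_graph G" and H: "regular_graph H" and GH: "labels G = verts H"
    and x: "x \<in> verts G \<times> verts H"
  shows "adj_mult (zigzag G H) \<alpha> x = fiber_mult H (\<lambda>y. fiber_mult H \<alpha> (rot G y)) x"
proof -
  note RG = regular_graphD[OF G] and RH = regular_graphD[OF H]
  obtain v k where vk: "x = (v, k)" "v \<in> verts G" "k \<in> verts H"
    using x by blast
  let ?L = "labels H"
  let ?y = "\<lambda>i. rot G (v, fst (rot H (k, i)))"
  have y: "snd (?y i) \<in> verts H" if "i \<in> ?L" for i
    using RH(5)[of "(k, i)"] RG(5)[of "(v, fst (rot H (k, i)))"] that vk GH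
    by (auto simp: mem_Times_iff)
  have "adj_mult (zigzag G H) \<alpha> x = (\<Sum>p\<in>?L \<times> ?L.
      \<alpha> (fst (?y (fst p)), fst (rot H (snd (?y (fst p)), snd p)))) / (card ?L * card ?L)"
    using vk by (subst adj_mult_eq[OF regular_graph_zigzag[OF G H GH]])
      (auto simp: zigzag_def Let_def case_prod_beta card_cartesian_product
        intro!: arg_cong2[where f = "(/)"] sum.cong)
  also have "\<dots> = (\<Sum>i\<in>?L. \<Sum>j\<in>?L. \<alpha> (fst (?y i), fst (rot H (snd (?y i), j)))) / (card ?L * card ?L)"
    by (simp add: sum.cartesian_product case_prod_beta)
  also have "\<dots> = (\<Sum>i\<in>?L. fiber_mult H \<alpha> (?y i)) / card ?L"
    using y by (simp add: fiber_mult_def adj_mult_eq[OF H] flip: sum_divide_distrib)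
  also have "\<dots> = fiber_mult H (\<lambda>y. fiber_mult H \<alpha> (rot G y)) x"
    using vk by (simp add: fiber_mult_def adj_mult_eq[OF H])
  finally show ?thesis .
qed

section \<open>Fiber means, deviations and the bound for the zig-zag product\<close>

lemma L2_set_fst:
  assumes "finite K"
  shows "L2_set (\<lambda>x. f (fst x)) (V \<times> K) = sqrt (card K) * L2_set f V"
proof -
  have "(\<Sum>x\<in>V \<times> K. (f (fst x))\<^sup>2) = (\<Sum>v\<in>V. \<Sum>k\<in>K. (f v)\<^sup>2)"
    unfolding sum.cartesian_product by (simp add: case_prod_beta)
  then show ?thesis
    by (simp add: L2_set_def real_sqrt_mult flip: sum_distrib_left)
qed

lemma L2_set_fiber_mean:
  assumes "finite K" "K \<noteq> {}"
  shows "(L2_set \<alpha> (V \<times> K))\<^sup>2 = (L2_set (\<lambda>x. fiber_mean K \<alpha> (fst x)) (V \<times> K))\<^sup>2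
      + (L2_set (\<lambda>x. \<alpha> x - fiber_mean K \<alpha> (fst x)) (V \<times> K))\<^sup>2"
proof -
  have "(\<Sum>v\<in>V. \<Sum>k\<in>K. (\<alpha> (v, k))\<^sup>2)
      = (\<Sum>v\<in>V. card K * (fiber_mean K \<alpha> v)\<^sup>2 + (\<Sum>k\<in>K. (\<alpha> (v, k) - fiber_mean K \<alpha> v)\<^sup>2))"
    by (rule sum.cong[OF refl], rule sum_power2_deviation[OF assms], simp only: fiber_mean_def)
  also have "\<dots> = (\<Sum>v\<in>V. \<Sum>k\<in>K. (fiber_mean K \<alpha> v)\<^sup>2)
      + (\<Sum>v\<in>V. \<Sum>k\<in>K. (\<alpha> (v, k) - fiber_mean K \<alpha> v)\<^sup>2)"
    by (simp add: sum.distrib)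
  finally show ?thesis
    unfolding sum.cartesian_product by (simp add: L2_set_power2 case_prod_beta)
qed

lemma fiber_mean_fiber_mult:
  assumes "regular_graph H"
  shows "fiber_mean (verts H) (fiber_mult H \<alpha>) v = fiber_mean (verts H) \<alpha> v"
  by (simp add: fiber_mean_def fiber_mult_def sum_adj_mult[OF assms])

text \<open>\<open>B\<close> fixes vectors constant on fibers, so it maps deviations to deviations.
  On each fiber these have sum zero, and the eigenvalue bound of \<open>H\<close> applies there
  separately.\<close>

lemma L2_fiber_mult_deviation_le:
  fixes \<alpha> :: "'v \<times> 'k \<Rightarrow> real"
  assumes H: "regular_graph H" and l: "second_eigenvalue H \<le> l" "l \<ge> 0"
  shows "L2_set (\<lambda>x. fiber_mult H \<alpha> x - fiber_mean (verts H) (fiber_mult H \<alpha>) (fst x)) (V \<times> verts H)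
      \<le> l * L2_set (\<lambda>x. \<alpha> x - fiber_mean (verts H) \<alpha> (fst x)) (V \<times> verts H)"
proof (rule power2_le_imp_le)
  note R = regular_graphD[OF H]
  let ?K = "verts H"
  let ?d = "\<lambda>v k. \<alpha> (v, k) - fiber_mean ?K \<alpha> v"
  have "(\<Sum>k\<in>?K. (fiber_mult H \<alpha> (v, k) - fiber_mean ?K \<alpha> v)\<^sup>2) \<le> l\<^sup>2 * (\<Sum>k\<in>?K. (?d v k)\<^sup>2)" for v
  proof -
    have "(\<Sum>k\<in>?K. ?d v k) = 0"
      using R by (simp add: sum_subtractf fiber_mean_def)
    then have "L2_set (adj_mult H (?d v)) ?K \<le> l * L2_set (?d v) ?K"
      using L2_adj_mult_le_second_eigenvalue[OF H, of "?d v"] l(1)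
      by (meson L2_set_nonneg mult_right_mono order_trans)
    then have "(L2_set (adj_mult H (?d v)) ?K)\<^sup>2 \<le> (l * L2_set (?d v) ?K)\<^sup>2"
      by (intro power_mono) auto
    then show ?thesis
      by (simp add: L2_set_power2 power_mult_distrib adj_mult_diff_const[OF H] fiber_mult_def)
  qed
  then have "(\<Sum>v\<in>V. \<Sum>k\<in>?K. (fiber_mult H \<alpha> (v, k) - fiber_mean ?K \<alpha> v)\<^sup>2)
      \<le> l\<^sup>2 * (\<Sum>v\<in>V. \<Sum>k\<in>?K. (?d v k)\<^sup>2)"
    unfolding sum_distrib_left[of _ _ V] by (rule sum_mono)
  then show "(L2_set (\<lambda>x. fiber_mult H \<alpha> x - fiber_mean ?K (fiber_mult H \<alpha>) (fst x)) (V \<times> ?K))\<^sup>2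
      \<le> (l * L2_set (\<lambda>x. \<alpha> x - fiber_mean ?K \<alpha> (fst x)) (V \<times> ?K))\<^sup>2"
    unfolding sum.cartesian_product
    by (simp add: L2_set_power2 power_mult_distrib case_prod_beta fiber_mean_fiber_mult[OF H])
qed (simp add: l)

text \<open>Here \<open>a\<close> and \<open>b\<close> are the lengths of the components of a vector that are constant,
  respectively of mean zero, on the fibers. Two upper bounds on the result are available: the first
  assumption on \<open>g\<close> is the better one if \<open>b\<close> is small, the second one if it is not.\<close>
lemma zigzag_contraction:
  fixes a b g l m :: real
  assumes "a \<ge> 0" "b \<ge> 0" "g \<ge> 0" "0 \<le> l" "l \<le> 1" "0 \<le> m" "m \<le> 1"
    and g1: "g \<le> m * a + l * b" and g2: "g\<^sup>2 \<le> a\<^sup>2 + l\<^sup>2 * b\<^sup>2"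
  shows "(1 - l\<^sup>2) * g\<^sup>2 + l\<^sup>2 * (a\<^sup>2 + l\<^sup>2 * b\<^sup>2)
    \<le> (1 - (1 - l\<^sup>2) * ((1 - m) / 2)\<^sup>2) * (a\<^sup>2 + b\<^sup>2)"
proof -
  \<comment> \<open>Half the gap of \<open>m\<close>, so that a \<open>b\<close> below
    \<open>e * n\<close> still leaves \<open>g\<close> at most
    \<open>(m + e) * n = (1 - e) * n\<close>.\<close>
  define e where "e = (1 - m) / 2"
  define n where "n = sqrt (a\<^sup>2 + b\<^sup>2)"
  have e: "0 \<le> e" "e \<le> 1" "m = 1 - 2 * e"
    using assms by (simp_all add: e_def field_simps)
  have n: "n\<^sup>2 = a\<^sup>2 + b\<^sup>2" "n \<ge> 0" "a \<le> n"
    by (auto simp: n_def real_le_rsqrt)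
  have l2: "0 \<le> 1 - l\<^sup>2"
    using assms by (simp add: power_le_one)
  have "(1 - l\<^sup>2) * g\<^sup>2 + l\<^sup>2 * (a\<^sup>2 + l\<^sup>2 * b\<^sup>2) \<le> (1 - (1 - l\<^sup>2) * e\<^sup>2) * n\<^sup>2"
  \<comment> \<open>For large \<open>b\<close>, the bound \<open>g2\<close> reduces the left side to
    \<open>a\<^sup>2 + l\<^sup>2 * b\<^sup>2\<close>, which is \<open>n\<^sup>2\<close> minus
    \<open>(1 - l\<^sup>2) * b\<^sup>2\<close>. For small \<open>b\<close>, the gain comes from
    \<open>g1\<close>.\<close>
  proof (cases "b \<ge> e * n")
    case True
    then have "(e * n)\<^sup>2 \<le> b\<^sup>2"
      using e n by (intro power_mono) auto
    then have "(1 - l\<^sup>2) * (e\<^sup>2 * n\<^sup>2) \<le> (1 - l\<^sup>2) * b\<^sup>2"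
      using l2 by (intro mult_left_mono) (auto simp: power_mult_distrib)
    moreover have "(1 - l\<^sup>2) * g\<^sup>2 \<le> (1 - l\<^sup>2) * (a\<^sup>2 + l\<^sup>2 * b\<^sup>2)"
      using g2 l2 by (rule mult_left_mono)
    ultimately show ?thesis
      using n(1) by (simp add: algebra_simps)
  next
    case False
    have "l * b \<le> e * n"
      using False assms mult_right_mono[of l 1 b] by simp
    moreover have "m * a \<le> m * n"
      using n assms by (intro mult_left_mono) auto
    ultimately have "g \<le> (1 - e) * n"
      using g1 e by (simp add: algebra_simps)
    then have "g\<^sup>2 \<le> ((1 - e) * n)\<^sup>2"
      using assms by (intro power_mono) auto
    also have "\<dots> \<le> (1 - e\<^sup>2) * n\<^sup>2"
    proof -
      have "e * e \<le> e * 1"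
        using e by (intro mult_left_mono) auto
      then have "(1 - e)\<^sup>2 \<le> 1 - e\<^sup>2"
        by (simp add: power2_eq_square algebra_simps)
      then show ?thesis
        unfolding power_mult_distrib by (rule mult_right_mono) simp
    qed
    finally have "(1 - l\<^sup>2) * g\<^sup>2 \<le> (1 - l\<^sup>2) * ((1 - e\<^sup>2) * n\<^sup>2)"
      using l2 by (rule mult_left_mono)
    moreover have "l\<^sup>2 * (a\<^sup>2 + l\<^sup>2 * b\<^sup>2) \<le> l\<^sup>2 * n\<^sup>2"
      using assms mult_right_mono[of "l\<^sup>2" 1 "b\<^sup>2"]
      by (intro mult_left_mono) (auto simp: n power_le_one)
    ultimately show ?thesis
      by (simp add: algebra_simps)
  qed
  then show ?thesis
    by (simp add: n e_def)
qed

theorem second_eigenvalue_zigzag_le: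
  fixes G :: "('v, 'k) rot_graph" and H :: "('k, 'l) rot_graph"
  assumes G: "regular_graph G" and H: "regular_graph H" and GH: "labels G = verts H"
    and m: "second_eigenvalue G \<le> m" "0 \<le> m" "m \<le> 1"
    and l: "second_eigenvalue H \<le> l" "0 \<le> l" "l \<le> 1"
  shows "second_eigenvalue (zigzag G H) \<le> sqrt (1 - (1 - l\<^sup>2) * ((1 - m) / 2)\<^sup>2)"
proof (rule second_eigenvalue_le[OF regular_graph_zigzag[OF G H GH]])
  let ?c = "1 - (1 - l\<^sup>2) * ((1 - m) / 2)\<^sup>2"
  have "(1 - l\<^sup>2) * ((1 - m) / 2)\<^sup>2 \<le> 1"
    using m l by (intro mult_le_one power_le_one) auto
  then have c: "?c \<ge> 0"
    by simp
  then show "sqrt ?c \<ge> 0"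
    by simp
  note RG = regular_graphD[OF G] and RH = regular_graphD[OF H]
  let ?K = "verts H" and ?V = "verts G"
  let ?X = "?V \<times> ?K"
  let ?mean = "fiber_mean ?K :: ('v \<times> 'k \<Rightarrow> real) \<Rightarrow> 'v \<Rightarrow> real"
  fix \<alpha> :: "'v \<times> 'k \<Rightarrow> real"
  assume sum0: "(\<Sum>x\<in>verts (zigzag G H). \<alpha> x) = 0"
  let ?avg = "\<lambda>\<alpha>. L2_set (\<lambda>x. ?mean \<alpha> (fst x)) ?X"
  let ?dev = "\<lambda>\<alpha>. L2_set (\<lambda>x. \<alpha> x - ?mean \<alpha> (fst x)) ?X"
  define \<beta> where "\<beta> = fiber_mult H \<alpha>"
  define \<gamma> where "\<gamma> y = \<beta> (rot G y)" for y
  \<comment> \<open>With \<open>\<gamma>\<close> the image \<open>P B \<alpha>\<close>,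
    \<open>\<eta>\<close> is what \<open>P\<close> makes of the deviation part of
    \<open>\<beta>\<close>; the rest of \<open>\<gamma>\<close> comes from the fiber means.\<close>
  define \<eta> where "\<eta> y = \<beta> (rot G y) - ?mean \<beta> (fst (rot G y))" for y
  note pyth = L2_set_fiber_mean[OF RH(1,2)]
  have mean_\<beta>: "?mean \<beta> = ?mean \<alpha>"
    by (simp add: \<beta>_def fiber_mean_fiber_mult[OF H] fun_eq_iff)
  have dev_\<beta>: "?dev \<beta> \<le> l * ?dev \<alpha>"
    unfolding \<beta>_def by (rule L2_fiber_mult_deviation_le[OF H l(1,2)])
  have rot_inv: "L2_set (\<lambda>y. f (rot G y)) ?X = L2_set f ?X" for f :: "'v \<times> 'k \<Rightarrow> real"
    using sum_rot[OF G, of "\<lambda>x. (f x)\<^sup>2"] by (simp add: L2_set_def GH)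
  have "(L2_set \<gamma> ?X)\<^sup>2 = (?avg \<alpha>)\<^sup>2 + (?dev \<beta>)\<^sup>2"
    using rot_inv[of \<beta>] pyth[of \<beta> ?V] by (simp add: \<gamma>_def[abs_def] mean_\<beta>)
  also have "(?dev \<beta>)\<^sup>2 \<le> (l * ?dev \<alpha>)\<^sup>2"
    using dev_\<beta> by (intro power_mono) auto
  finally have norm_\<gamma>: "(L2_set \<gamma> ?X)\<^sup>2 \<le> (?avg \<alpha>)\<^sup>2 + l\<^sup>2 * (?dev \<alpha>)\<^sup>2"
    by (simp add: power_mult_distrib)

  \<comment> \<open>The fiber over \<open>v\<close> is the set of edge ends at \<open>v\<close>, so
    averaging the fiber means found across these edges is one step of \<open>G\<close>.\<close>
  have mean_\<gamma>: "?mean \<gamma> v = adj_mult G (?mean \<alpha>) v + ?mean \<eta> v" if "v \<in> ?V" for v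
    using adj_mult_eq[OF G that, of "?mean \<alpha>"]
    by (simp add: \<gamma>_def \<eta>_def mean_\<beta> fiber_mean_def GH flip: add_divide_distrib sum.distrib)
  have avg1: "?avg \<gamma> \<le> L2_set (\<lambda>x. adj_mult G (?mean \<alpha>) (fst x)) ?X + ?avg \<eta>"
  proof -
    have "?avg \<gamma> = L2_set (\<lambda>x. adj_mult G (?mean \<alpha>) (fst x) + ?mean \<eta> (fst x)) ?X"
      by (intro L2_set_cong) (auto simp: mean_\<gamma>)
    also have "\<dots> \<le> L2_set (\<lambda>x. adj_mult G (?mean \<alpha>) (fst x)) ?X + ?avg \<eta>"
      by (rule L2_set_triangle_ineq)
    finally show ?thesis .
  qed
  have avg2: "L2_set (\<lambda>x. adj_mult G (?mean \<alpha>) (fst x)) ?X \<le> m * ?avg \<alpha>"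
  proof -
    have "(\<Sum>v\<in>?V. ?mean \<alpha> v) = (\<Sum>x\<in>?X. \<alpha> x) / card ?K"
      by (simp add: fiber_mean_def sum.cartesian_product flip: sum_divide_distrib)
    then have "L2_set (adj_mult G (?mean \<alpha>)) ?V \<le> second_eigenvalue G * L2_set (?mean \<alpha>) ?V"
      using sum0 by (intro L2_adj_mult_le_second_eigenvalue[OF G]) (simp add: zigzag_def)
    also have "\<dots> \<le> m * L2_set (?mean \<alpha>) ?V"
      using m by (intro mult_right_mono) auto
    finally have "sqrt (card ?K) * L2_set (adj_mult G (?mean \<alpha>)) ?V
        \<le> sqrt (card ?K) * (m * L2_set (?mean \<alpha>) ?V)"
      by (rule mult_left_mono) simp
    then show ?thesis
      unfolding L2_set_fst[OF RH(1)] by (simp add: ac_simps)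
  qed
  \<comment> \<open>Taking fiber means does not increase the norm, and \<open>P\<close> preserves
    it.\<close>
  have avg3: "?avg \<eta> \<le> ?dev \<beta>"
  proof -
    have "?avg \<eta> \<le> L2_set \<eta> ?X"
      by (rule power2_le_imp_le) (simp_all add: pyth[of \<eta> ?V])
    also have "\<dots> = ?dev \<beta>"
      using rot_inv[of "\<lambda>x. \<beta> x - ?mean \<beta> (fst x)"] by (simp add: \<eta>_def[abs_def])
    finally show ?thesis .
  qed
  have avg_\<gamma>: "?avg \<gamma> \<le> m * ?avg \<alpha> + l * ?dev \<alpha>"
    using avg1 avg2 avg3 dev_\<beta> by linarith

  have "(?dev (fiber_mult H \<gamma>))\<^sup>2 \<le> (l * ?dev \<gamma>)\<^sup>2"
    by (intro power_mono L2_fiber_mult_deviation_le[OF H l(1,2)]) auto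
  then have "(L2_set (fiber_mult H \<gamma>) ?X)\<^sup>2 \<le> (?avg \<gamma>)\<^sup>2 + (l * ?dev \<gamma>)\<^sup>2"
    using pyth[of "fiber_mult H \<gamma>" ?V] by (simp add: fiber_mean_fiber_mult[OF H])
  also have "(l * ?dev \<gamma>)\<^sup>2 = l\<^sup>2 * ((L2_set \<gamma> ?X)\<^sup>2 - (?avg \<gamma>)\<^sup>2)"
    using pyth[of \<gamma> ?V] by (simp add: power_mult_distrib)
  \<comment> \<open>Since \<open>l \<le> 1\<close>, this form has nonnegative coefficients, so upper
    bounds on both \<open>?avg \<gamma>\<close> and the norm of \<open>\<gamma>\<close> can be
    inserted.\<close>
  also have "(?avg \<gamma>)\<^sup>2 + l\<^sup>2 * ((L2_set \<gamma> ?X)\<^sup>2 - (?avg \<gamma>)\<^sup>2)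
      = (1 - l\<^sup>2) * (?avg \<gamma>)\<^sup>2 + l\<^sup>2 * (L2_set \<gamma> ?X)\<^sup>2"
    by (simp add: algebra_simps)
  also have "\<dots> \<le> (1 - l\<^sup>2) * (?avg \<gamma>)\<^sup>2 + l\<^sup>2 * ((?avg \<alpha>)\<^sup>2 + l\<^sup>2 * (?dev \<alpha>)\<^sup>2)"
    using norm_\<gamma> by (intro add_left_mono mult_left_mono) auto
  also have "\<dots> \<le> ?c * ((?avg \<alpha>)\<^sup>2 + (?dev \<alpha>)\<^sup>2)"
  proof (rule zigzag_contraction[OF _ _ _ l(2,3) m(2,3) avg_\<gamma>])
    have "(?avg \<gamma>)\<^sup>2 \<le> (L2_set \<gamma> ?X)\<^sup>2"
      using pyth[of \<gamma> ?V] by simp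
    then show "(?avg \<gamma>)\<^sup>2 \<le> (?avg \<alpha>)\<^sup>2 + l\<^sup>2 * (?dev \<alpha>)\<^sup>2"
      using norm_\<gamma> by (rule order_trans)
  qed simp_all
  also have "\<dots> = (sqrt ?c * L2_set \<alpha> ?X)\<^sup>2"
    using c pyth[of \<alpha> ?V] by (simp add: power_mult_distrib)
  finally have "L2_set (fiber_mult H \<gamma>) ?X \<le> sqrt ?c * L2_set \<alpha> ?X"
    by (rule power2_le_imp_le) (intro mult_nonneg_nonneg real_sqrt_ge_zero c L2_set_nonneg)
  moreover have "L2_set (adj_mult (zigzag G H) \<alpha>) ?X = L2_set (fiber_mult H \<gamma>) ?X"
    by (intro L2_set_cong) (auto simp: adj_mult_zigzag[OF G H GH] \<gamma>_def[abs_def] \<beta>_def)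
  ultimately show "L2_set (adj_mult (zigzag G H) \<alpha>) (verts (zigzag G H))
      \<le> sqrt ?c * L2_set \<alpha> (verts (zigzag G H))"
    by (simp add: zigzag_def)
qed

section \<open>The spectral gap of odd cycles\<close>

lemma periodic_add_mult:
  fixes h :: "nat \<Rightarrow> 'a"
  assumes "\<And>t. h (t + D) = h t"
  shows "h (t + q * D) = h t"
  by (induction q) (use assms in \<open>simp_all add: add.assoc[symmetric] add.commute[of D]\<close>)

text \<open>At most \<open>D\<close> steps of length 2 lead from 0 to any residue, each changing
  \<open>h\<close> by at most the root of the right-hand sum. This costs \<open>D\<^sup>2\<close>
  per point, and there are \<open>D\<close> points.\<close>

lemma odd_period_poincare:
  fixes h :: "nat \<Rightarrow> real"
  assumes "odd D" and period: "\<And>t. h (t + D) = h t" and sum0: "(\<Sum>t<D. h t) = 0"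
  shows "(\<Sum>t<D. (h t)\<^sup>2) \<le> real D ^ 3 * (\<Sum>t<D. (h (t + 2) - h t)\<^sup>2)"
proof -
  let ?S = "\<Sum>t<D. (h (t + 2) - h t)\<^sup>2"
  have D: "D > 0"
    using \<open>odd D\<close> by (rule odd_pos)
  have S: "?S \<ge> 0"
    by (simp add: sum_nonneg)
  have mod: "h (t mod D + s) = h (t + s)" for t s
    using periodic_add_mult[of h D, OF period, of "t mod D + s" "t div D"] by (simp add: ac_simps)
  have step: "\<bar>h (t + 2) - h t\<bar> \<le> sqrt ?S" for t
  proof -
    have "(h (t mod D + 2) - h (t mod D))\<^sup>2 \<le> ?S"
      using D by (intro member_le_sum) auto
    then show ?thesis
      using mod[of t 2] mod[of t 0] by (simp add: real_le_rsqrt)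
  qed
  have walk: "\<bar>h (2 * k) - h 0\<bar> \<le> k * sqrt ?S" for k
  proof (induction k)
    case (Suc k)
    have "h (2 * Suc k) - h 0 = (h (2 * k + 2) - h (2 * k)) + (h (2 * k) - h 0)"
      by simp
    then show ?case
      using Suc step[of "2 * k"] by (simp add: algebra_simps)
  qed simp
  have dist: "(h t - h 0)\<^sup>2 \<le> (real D)\<^sup>2 * ?S" if "t < D" for t
  proof -
    \<comment> \<open>An even \<open>t\<close> is reached after \<open>t div 2\<close> steps; for
      odd \<open>t\<close>, the even number \<open>t + D\<close> represents the same residue and is
      below \<open>2 * D\<close>.\<close>
    obtain k where k: "k \<le> D" "h t = h (2 * k)"
    proof (cases "even t")
      case True
      then show ?thesis
        using that[of "t div 2"] \<open>t < D\<close> by auto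
    next
      case False
      then have "even (t + D)"
        using \<open>odd D\<close> by simp
      then show ?thesis
        using that[of "(t + D) div 2"] \<open>t < D\<close> period[of t] by auto
    qed
    have "\<bar>h t - h 0\<bar> \<le> D * sqrt ?S"
      using walk[of k] k mult_right_mono[of "real k" "real D" "sqrt ?S"] S by simp
    then have "\<bar>h t - h 0\<bar>\<^sup>2 \<le> (D * sqrt ?S)\<^sup>2"
      by (rule power_mono) simp
    then show ?thesis
      using S by (simp add: power_mult_distrib)
  qed
  \<comment> \<open>As \<open>h\<close> has sum zero, subtracting the constant \<open>h 0\<close>
    can only increase the sum of squares.\<close>
  have "(\<Sum>t<D. (h t)\<^sup>2) \<le> (\<Sum>t<D. (h t)\<^sup>2) + D * (h 0)\<^sup>2"
    by simp
  also have "\<dots> = (\<Sum>t<D. (h t)\<^sup>2) - 2 * h 0 * (\<Sum>t<D. h t) + D * (h 0)\<^sup>2"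
    by (simp add: sum0)
  also have "\<dots> = (\<Sum>t<D. (h t - h 0)\<^sup>2)"
    by (simp add: power2_diff sum.distrib sum_subtractf sum_distrib_left sum_distrib_right ac_simps)
  also have "\<dots> \<le> (\<Sum>t<D. (real D)\<^sup>2 * ?S)"
    by (intro sum_mono dist) auto
  also have "\<dots> = real D ^ 3 * ?S"
    by (simp add: power2_eq_square power3_eq_cube)
  finally show ?thesis .
qed

text \<open>Moving the window by one drops \<open>h s\<close> and gains \<open>h (s + D)\<close>,
  which are equal.\<close>

lemma sum_periodic_shift:
  fixes h :: "nat \<Rightarrow> 'a::cancel_comm_monoid_add"
  assumes "\<And>t. h (t + D) = h t"
  shows "(\<Sum>t<D. h (t + s)) = (\<Sum>t<D. h t)"
proof (induction s)
  case (Suc s)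
  have "h s + (\<Sum>t<D. h (Suc t + s)) = (\<Sum>t<D. h (t + s)) + h s"
    using sum.lessThan_Suc_shift[of "\<lambda>t. h (t + s)" D] assms[of s]
    by (simp add: add.commute[of D])
  then show ?case
    using Suc by (simp add: add.commute)
qed simp

text \<open>The periodic extension \<open>h\<close> absorbs the wraparound. Centering at
  \<open>t + 1\<close> makes the neighbors \<open>t\<close> and \<open>t + 2\<close> without
  subtraction; \<open>t = 0\<close> stands for the vertex \<open>D\<close>.\<close>

lemma adj_mult_cycle:
  assumes C: "cycle_graph D C" and t: "t < D"
    and period: "\<And>t. h (t + D) = h t" and h: "\<And>v. v \<in> {1..D} \<Longrightarrow> h v = \<alpha> v"
  shows "adj_mult C \<alpha> (t + 1) = (h t + h (t + 2)) / 2"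
proof -
  have R: "regular_graph C" and VL: "verts C = {1..D}" "labels C = {1..2}"
    using C by (auto simp: cycle_graph_def)
  have t1: "t + 1 \<in> {1..D}"
    using t by auto
  obtain i j where ij: "{i, j} = {1..2::nat}"
    and ci: "[int (fst (rot C (t + 1, i))) = int (t + 1) + 1] (mod int D)"
    and cj: "[int (fst (rot C (t + 1, j))) = int (t + 1) - 1] (mod int D)"
    using C t1 unfolding cycle_graph_def by blast
  have ends: "fst (rot C (t + 1, k)) \<in> {1..D}" if "k \<in> {1..2}" for k
    using regular_graphD(5)[OF R, of "(t + 1, k)"] t1 that by (auto simp: VL mem_Times_iff)
  have mod: "h (r mod D) = h r" for r
    using periodic_add_mult[of h D, OF period, of "r mod D" "r div D"] by simp
  have cong: "h r = h s" if "[int r = int s] (mod int D)" for r s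
    using that mod[of r] mod[of s] unfolding cong_int_iff by (simp add: cong_def)
  have "{1..2} = {1::nat, 2}"
    by auto
  \<comment> \<open>Distinct labels keep two terms in the sum even when both lead to the same
    vertex, as for \<open>D = 1\<close>.\<close>
  then have "i \<noteq> j" "i \<in> {1..2}" "j \<in> {1..2}"
    using ij by (auto simp: doubleton_eq_iff)
  have "adj_mult C \<alpha> (t + 1) = (\<Sum>k\<in>{i, j}. \<alpha> (fst (rot C (t + 1, k)))) / 2"
    using adj_mult_eq[OF R, of "t + 1" \<alpha>] t1 by (simp add: VL ij)
  also have "\<dots> = (\<alpha> (fst (rot C (t + 1, i))) + \<alpha> (fst (rot C (t + 1, j)))) / 2"
    using \<open>i \<noteq> j\<close> by simp
  also have "\<alpha> (fst (rot C (t + 1, i))) = h (t + 2)"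
    using h[OF ends[OF \<open>i \<in> {1..2}\<close>]] cong[of "fst (rot C (t + 1, i))" "t + 2"] ci by simp
  also have "\<alpha> (fst (rot C (t + 1, j))) = h t"
    using h[OF ends[OF \<open>j \<in> {1..2}\<close>]] cong[of "fst (rot C (t + 1, j))" t] cj by simp
  finally show ?thesis
    by (simp add: add.commute)
qed

text \<open>The loss of a quarter of the squared differences, combined with the Poincare constant
  \<open>D ^ 3\<close>, gives the term \<open>1 / (4 * real D ^ 3)\<close>.\<close>

lemma second_eigenvalue_cycle_le:
  assumes "odd D" and C: "cycle_graph D C"
  shows "second_eigenvalue C \<le> sqrt (1 - 1 / (4 * real D ^ 3))"
proof -
  have R: "regular_graph C" and VL: "verts C = {1..D}" "labels C = {1..2}"
    using C by (auto simp: cycle_graph_def)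
  have D: "D \<ge> 1"
    using odd_pos[OF \<open>odd D\<close>] by simp
  then have "1 \<le> real D ^ 3"
    by simp
  then have "1 \<le> 4 * real D ^ 3"
    by linarith
  then have c: "0 \<le> 1 - 1 / (4 * real D ^ 3)"
    using D by (simp add: divide_le_eq)
  have shift: "(\<Sum>v\<in>{1..D}. f v) = (\<Sum>t<D. f (t + 1))" for f :: "nat \<Rightarrow> real"
    by (rule sum.reindex_bij_witness[of _ "\<lambda>t. t + 1" "\<lambda>v. v - 1"]) auto
  show ?thesis
  proof (rule second_eigenvalue_le[OF R])
    fix \<alpha> :: "nat \<Rightarrow> real"
    assume sum0: "(\<Sum>v\<in>verts C. \<alpha> v) = 0"
    \<comment> \<open>Vertices are numbered from 1, so residue 0 belongs to vertex
      \<open>D\<close>.\<close>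
    define h where "h t = \<alpha> (if t mod D = 0 then D else t mod D)" for t
    have period: "h (t + D) = h t" for t
      by (simp add: h_def)
    have h: "h v = \<alpha> v" if "v \<in> {1..D}" for v
      using that by (cases "v = D") (auto simp: h_def)
    have total: "(\<Sum>v\<in>{1..D}. f (\<alpha> v)) = (\<Sum>t<D. f (h t))" for f :: "real \<Rightarrow> real"
    proof -
      have "(\<Sum>v\<in>{1..D}. f (\<alpha> v)) = (\<Sum>v\<in>{1..D}. f (h v))"
        by (rule sum.cong) (auto simp: h)
      also have "\<dots> = (\<Sum>t<D. f (h t))"
        unfolding shift by (rule sum_periodic_shift[of "\<lambda>t. f (h t)"]) (simp add: period)
      finally show ?thesis .
    qed
    have "(\<Sum>t<D. h t) = 0"
      using sum0 total[of "\<lambda>x. x"] by (simp add: VL)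
    note poincare = odd_period_poincare[OF \<open>odd D\<close> period this]
    have "(\<Sum>v\<in>{1..D}. (adj_mult C \<alpha> v)\<^sup>2) = (\<Sum>t<D. ((h t + h (t + 2)) / 2)\<^sup>2)"
      unfolding shift
    proof (intro sum.cong refl)
      fix t assume "t \<in> {..<D}"
      then have "adj_mult C \<alpha> (t + 1) = (h t + h (t + 2)) / 2"
        using period h by (intro adj_mult_cycle[OF C]) auto
      then show "(adj_mult C \<alpha> (t + 1))\<^sup>2 = ((h t + h (t + 2)) / 2)\<^sup>2"
        by (rule arg_cong)
    qed
    \<comment> \<open>The parallelogram identity, applied to each pair of neighbors.\<close>
    also have "\<dots> = (\<Sum>t<D. ((h t)\<^sup>2 + (h (t + 2))\<^sup>2) / 2 - (h (t + 2) - h t)\<^sup>2 / 4)"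
      by (intro sum.cong refl) (simp add: power2_eq_square field_simps)
    also have "\<dots> = ((\<Sum>t<D. (h t)\<^sup>2) + (\<Sum>t<D. (h (t + 2))\<^sup>2)) / 2
        - (\<Sum>t<D. (h (t + 2) - h t)\<^sup>2) / 4"
      by (simp add: sum_subtractf sum.distrib flip: sum_divide_distrib)
    also have "(\<Sum>t<D. (h (t + 2))\<^sup>2) = (\<Sum>t<D. (h t)\<^sup>2)"
      by (rule sum_periodic_shift[of "\<lambda>t. (h t)\<^sup>2"]) (simp add: period)
    also have "((\<Sum>t<D. (h t)\<^sup>2) + (\<Sum>t<D. (h t)\<^sup>2)) / 2 - (\<Sum>t<D. (h (t + 2) - h t)\<^sup>2) / 4
        \<le> (1 - 1 / (4 * real D ^ 3)) * (\<Sum>t<D. (h t)\<^sup>2)"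
      using poincare D by (simp add: field_simps)
    also have "(\<Sum>t<D. (h t)\<^sup>2) = (\<Sum>v\<in>{1..D}. (\<alpha> v)\<^sup>2)"
      by (rule total[symmetric])
    finally have "(L2_set (adj_mult C \<alpha>) {1..D})\<^sup>2
        \<le> (sqrt (1 - 1 / (4 * real D ^ 3)) * L2_set \<alpha> {1..D})\<^sup>2"
      using c by (simp add: L2_set_power2 power_mult_distrib)
    then show "L2_set (adj_mult C \<alpha>) (verts C) \<le> sqrt (1 - 1 / (4 * real D ^ 3)) * L2_set \<alpha> (verts C)"
      unfolding VL
      by (rule power2_le_imp_le) (intro mult_nonneg_nonneg real_sqrt_ge_zero c L2_set_nonneg)
  qed (use c in simp)
qed

section \<open>A bound depending only on the eigenvalue bound and the degree\<close>

theorem corollary3p4: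
  fixes \<mu> :: real and D :: nat
  assumes "\<mu> < 1" and "odd D"
  shows "\<exists>\<mu>'::real. \<mu>' < 1 \<and>
           (\<forall>(N::nat) (G::(nat, nat) rot_graph) (C::(nat, nat) rot_graph).
              spectral_graph N D \<mu> G \<and> labels G = {1..D} \<and> cycle_graph D C
                \<longrightarrow> spectral_graph (N * D) 4 \<mu>' (zigzag G C))"
proof -
  \<comment> \<open>\<open>\<mu>\<close> may be negative, while the zig-zag bound asks for a
    nonnegative \<open>m\<close>.\<close>
  define m where "m = max 0 \<mu>"
  define l where "l = sqrt (1 - 1 / (4 * real D ^ 3))"
  have m: "\<mu> \<le> m" "0 \<le> m" "m < 1"
    using assms by (auto simp: m_def)
  have "D > 0"
    using \<open>odd D\<close> by (rule odd_pos)
  then have "1 \<le> real D ^ 3"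
    by simp
  then have "1 \<le> 4 * real D ^ 3"
    by linarith
  then have l: "0 \<le> l" "l < 1"
    using \<open>D > 0\<close> by (simp_all add: l_def divide_le_eq)
  \<comment> \<open>The witness is built from \<open>\<mu>\<close> and \<open>D\<close> alone,
    before \<open>N\<close>, \<open>G\<close> and \<open>C\<close> are fixed. It is below 1 because
    both \<open>l\<close> and \<open>m\<close> are.\<close>
  define c where "c = sqrt (1 - (1 - l\<^sup>2) * ((1 - m) / 2)\<^sup>2)"
  have "l\<^sup>2 < 1"
    using l by (simp add: power_less_one_iff)
  then have "c < 1"
    using m by (simp add: c_def)
  moreover have "spectral_graph (N * D) 4 c (zigzag G C)"
    if G: "spectral_graph N D \<mu> G" "labels G = {1..D}" and C: "cycle_graph D C"
    for N and G C :: "(nat, nat) rot_graph"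
  proof -
    have RC: "regular_graph C" and VL: "verts C = {1..D}" "labels C = {1..2}"
      using C by (auto simp: cycle_graph_def)
    have RG: "regular_graph G" "card (verts G) = N" "second_eigenvalue G \<le> m" and GC: "labels G = verts C"
      using G m VL by (auto simp: spectral_graph_def)
    have "second_eigenvalue (zigzag G C) \<le> c"
      unfolding c_def using m l
      by (intro second_eigenvalue_zigzag_le[OF RG(1) RC GC RG(3)]
          second_eigenvalue_cycle_le[OF \<open>odd D\<close> C, folded l_def]) simp_all
    moreover have "card (verts (zigzag G C)) = N * D" "card (labels (zigzag G C)) = 4"
      using RG(2) VL by (simp_all add: zigzag_def card_cartesian_product)
    ultimately show ?thesis
      using regular_graph_zigzag[OF RG(1) RC GC] by (simp add: spectral_graph_def)
  qed
  ultimately show ?thesis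
    by (intro exI[of _ c]) simp
qed

end
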